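(* Let $\sigma\subset\mathbb{R}^2$ be a circular arc of radius $1$ and of arc length less than $1.32$, and let $\sigma'$ be any image of $\sigma$ under an isometry of the plane. Then for every $\varepsilon>0$ there is a continuous motion $(g_t)_{t\in[0,1]}$ with $g_0=\mathrm{id}$ and $g_1(\sigma)=\sigma'$ such that the set $\bigcup_{t\in[0,1]} g_t(\sigma)$ of points touched by the moving arc has Lebesgue measure less than $\varepsilon$.
   Context: A continuous motion is a continuous map $t\mapsto g_t$ from $[0,1]$ into the group of orientation-preserving isometries of $\mathbb{R}^2$ (with its natural topology). The area of a set is its (two-dimensional) Lebesgue measure. *)

theory Defs
  imports "HOL-Analysis.Analysis"
begin

definition unit_arc :: "complex \<Rightarrow> real \<Rightarrow> real \<Rightarrow> complex set" where
  "unit_arc c a L = (\<lambda>\<theta>. c + cis \<theta>) ` {a..a + L}"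

definition plane_isometry :: "(complex \<Rightarrow> complex) \<Rightarrow> bool" where
  "plane_isometry f \<longleftrightarrow> (\<forall>x y. dist (f x) (f y) = dist x y)"

text \<open>Orientation-preserving isometries are exactly the maps z \<mapsto> u z + b with |u| = 1;
  the natural topology on this group is that of the pair (u, b).
  A continuous motion is thus given by continuous u, b on [0,1] with |u t| = 1.\<close>
definition motion_map :: "(real \<Rightarrow> complex) \<Rightarrow> (real \<Rightarrow> complex) \<Rightarrow> real \<Rightarrow> complex \<Rightarrow> complex" where
  "motion_map u b t z = u t * z + b t"

definition continuous_motion :: "(real \<Rightarrow> complex) \<Rightarrow> (real \<Rightarrow> complex) \<Rightarrow> bool" where
  "continuous_motion u b \<longleftrightarrow> continuous_on {0..1} u \<and> continuous_on {0..1} b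
     \<and> (\<forall>t\<in>{0..1}. norm (u t) = 1)"

end

theory Submission
  imports Defs
begin

text \<open>Turning the arc about its centre touches only a circle, so only the path of the centre
  matters. Translating in direction \<open>\<phi>\<close>, the points of the arc whose normal is within \<open>\<alpha>\<close> of being
  orthogonal to \<open>\<phi>\<close> touch an area of order \<open>\<alpha>\<^sup>2\<close> per unit length.
  Replace a segment of direction \<open>\<phi>\<close> by a fine zigzag of main steps of direction \<open>\<phi> + \<alpha>\<close> and side
  steps of direction \<open>\<phi> + L - pi/2\<close>, then treat each main step in the same way with a still
  finer zigzag, until the main direction is \<open>\<phi> + L\<close>. All refinements stay close to their
  predecessors, so each point of an arc of length \<open>L\<close> is paid for only in the stage in which it is
  almost tangent to the main steps, and the main steps have total area of order \<open>\<alpha>\<close>. The side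
  steps have \<open>sin L\<close> times the length of the original segment; as \<open>L < pi/2\<close>, repeating the
  construction on them makes the remaining cost arbitrarily small.\<close>

section \<open>Area swept by translated circular arcs\<close>

text \<open>The Minkowski sum of a set of centres and a piece of the unit circle. The order in which
  the centres are visited is immaterial, and the angles can be split and estimated piece by
  piece.\<close>

definition sweep :: "complex set \<Rightarrow> real set \<Rightarrow> complex set" where
  "sweep A I = (\<lambda>(c, \<theta>). c + cis \<theta>) ` (A \<times> I)"

lemma compact_sweep:
  assumes "compact A" "compact I"
  shows "compact (sweep A I)"
  unfolding sweep_def case_prod_unfold
  by (intro compact_continuous_image continuous_intros compact_Times assms)

lemma sweep_Un_left: "sweep (A \<union> B) I = sweep A I \<union> sweep B I"
  by (auto simp: sweep_def)

lemma sweep_Un_right: "sweep A (I \<union> J) = sweep A I \<union> sweep A J"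
  by (auto simp: sweep_def)

lemma sweep_empty [simp]: "sweep {} I = {}"
  by (simp add: sweep_def)

text \<open>Boxes correspond under the coordinate map with equal area, and boxes determine Lebesgue
  measure. This carries Jacobian bounds from \<open>real^2\<close> over to the complex
  plane.\<close>

lemma lborel_complex_eq_distr:
  "lborel = distr lborel borel (\<lambda>x::real^2. Complex (x $ 1) (x $ 2))"
proof (rule lborel_eqI)
  fix l u :: complex
  assume le: "\<And>b. b \<in> Basis \<Longrightarrow> l \<bullet> b \<le> u \<bullet> b"
  let ?v = "\<lambda>z. vector [Re z, Im z] :: real^2"
  have cont: "continuous_on UNIV (\<lambda>x::real^2. Complex (x $ 1) (x $ 2))"
    unfolding Complex_eq by (intro continuous_intros)
  have eq: "(\<lambda>x::real^2. Complex (x $ 1) (x $ 2)) -` box l u = box (?v l) (?v u)"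
    by (auto simp: box_def Basis_complex_def Basis_vec_def inner_axis UNIV_2)
  have "emeasure (distr lborel borel (\<lambda>x::real^2. Complex (x $ 1) (x $ 2))) (box l u)
      = emeasure lborel (box (?v l) (?v u))"
    using cont by (subst emeasure_distr) (auto simp: eq borel_measurable_continuous_onI)
  also have "\<dots> = (\<Prod>b\<in>Basis. (?v u - ?v l) \<bullet> b)"
    using le[of 1] le[of \<i>] by (intro emeasure_lborel_box)
      (auto simp: Basis_vec_def inner_axis UNIV_2 Basis_complex_def)
  also have "(\<Prod>b\<in>Basis. (?v u - ?v l) \<bullet> b) = (\<Prod>b\<in>Basis. (u - l) \<bullet> b)"
    by (simp add: Basis_vec_def UNIV_2 inner_axis Basis_complex_def axis_eq_axis)
  finally show "emeasure (distr lborel borel (\<lambda>x::real^2. Complex (x $ 1) (x $ 2))) (box l u)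
      = (\<Prod>b\<in>Basis. (u - l) \<bullet> b)" .
qed simp

lemma measure_lebesgue_Complex_image:
  fixes S :: "(real^2) set"
  assumes "compact S"
  shows "measure lebesgue ((\<lambda>x. Complex (x $ 1) (x $ 2)) ` S) = measure lebesgue S"
proof -
  let ?h = "\<lambda>x::real^2. Complex (x $ 1) (x $ 2)"
  have cont: "continuous_on UNIV ?h"
    unfolding Complex_eq by (intro continuous_intros)
  have comp: "compact (?h ` S)"
    using assms cont by (meson compact_continuous_image continuous_on_subset top_greatest)
  have vim: "?h -` (?h ` S) = S"
  proof -
    have "inj ?h" by (auto simp: inj_def vec_eq_iff forall_2)
    then show ?thesis by (rule inj_vimage_image_eq)
  qed
  have "emeasure lborel (?h ` S) = emeasure (distr lborel borel ?h) (?h ` S)"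
    by (simp flip: lborel_complex_eq_distr)
  also have "\<dots> = emeasure lborel S"
    using cont comp
    by (subst emeasure_distr) (auto simp: vim borel_measurable_continuous_onI borel_compact)
  finally show ?thesis
    using comp assms by (simp add: measure_def borel_compact)
qed

text \<open>The velocity \<open>cis \<phi>\<close> is almost tangent to the arc, so the Jacobian of the sweep is \<open>sin t\<close>
  at the point of angle \<open>\<phi> + pi/2 + t\<close>.\<close>
lemma measure_sweep_closed_segment_le:
  assumes "0 \<le> l" "0 \<le> \<alpha>"
  shows "measure lebesgue (sweep (closed_segment p (p + of_real l * cis \<phi>)) {\<phi> + pi/2..\<phi> + pi/2 + \<alpha>})
    \<le> l * \<alpha>\<^sup>2"
proof -
  let ?h = "\<lambda>x::real^2. Complex (x $ 1) (x $ 2)"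
  \<comment> \<open>\<open>x $ 1\<close> is the distance travelled along the segment and
    \<open>x $ 2\<close> the angle beyond \<open>\<phi> + pi/2\<close>, whose cosine and sine turn
    into \<open>- sin\<close> and \<open>cos\<close>.\<close>
  define f :: "real^2 \<Rightarrow> real^2" where
    "f = (\<lambda>x. vector [Re p, Im p] + (x $ 1) *\<^sub>R vector [cos \<phi>, sin \<phi>]
       + (- sin (\<phi> + x $ 2)) *\<^sub>R axis 1 1 + cos (\<phi> + x $ 2) *\<^sub>R axis 2 1)"
  define f' :: "real^2 \<Rightarrow> real^2 \<Rightarrow> real^2" where
    "f' = (\<lambda>x y. (y $ 1) *\<^sub>R vector [cos \<phi>, sin \<phi>]
       + (- cos (\<phi> + x $ 2) * y $ 2) *\<^sub>R axis 1 1 + (- sin (\<phi> + x $ 2) * y $ 2) *\<^sub>R axis 2 1)"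
  define R :: "(real^2) set" where "R = cbox 0 (vector [l, \<alpha>])"
  have R: "x \<in> R \<longleftrightarrow> 0 \<le> x $ 1 \<and> x $ 1 \<le> l \<and> 0 \<le> x $ 2 \<and> x $ 2 \<le> \<alpha>" for x
    by (auto simp: R_def mem_box_cart forall_2)
  have deriv: "(f has_derivative f' x) (at x within R)" for x
    unfolding f_def f'_def
    by (auto intro!: derivative_eq_intros bounded_linear.has_derivative[OF bounded_linear_vec_nth] ext
      simp: mult.commute)
  have det: "\<bar>det (matrix (f' x))\<bar> = \<bar>sin (x $ 2)\<bar>" for x
  proof -
    have "det (matrix (f' x)) = sin \<phi> * cos (\<phi> + x $ 2) - cos \<phi> * sin (\<phi> + x $ 2)"
      by (simp add: det_2 matrix_def f'_def axis_def)
    also have "\<dots> = - sin (x $ 2)"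
      using sin_diff[of \<phi> "\<phi> + x $ 2"] by simp
    finally show ?thesis by simp
  qed
  have fR: "compact (f ` R)"
    unfolding R_def f_def by (intro compact_continuous_image continuous_intros compact_cbox)
  \<comment> \<open>One factor \<open>\<alpha>\<close> bounds the Jacobian, the other is the height
    of the rectangle \<open>R\<close>.\<close>
  have "measure lebesgue (f ` R) \<le> \<alpha> * measure lebesgue R"
  proof (rule measure_bounded_differentiable_image)
    show "(\<lambda>x. \<bar>det (matrix (f' x))\<bar>) integrable_on R"
      unfolding det R_def by (intro integrable_continuous continuous_intros)
    show "\<bar>det (matrix (f' x))\<bar> \<le> \<alpha>" if "x \<in> R" for x
      using that abs_sin_x_le_abs_x[of "x $ 2"] unfolding det R by linarith
  qed (use deriv in \<open>auto simp: R_def\<close>)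
  also have "measure lebesgue R = l * \<alpha>"
  proof -
    have "0 \<in> R" using assms by (simp add: R)
    then have "R \<noteq> {}" by blast
    then show ?thesis
      unfolding R_def by (simp add: content_cbox_cart UNIV_2)
  qed
  finally have meas: "measure lebesgue (f ` R) \<le> l * \<alpha>\<^sup>2"
    by (simp add: power2_eq_square mult_ac)
  have sub: "sweep (closed_segment p (p + of_real l * cis \<phi>)) {\<phi> + pi/2..\<phi> + pi/2 + \<alpha>} \<subseteq> ?h ` f ` R"
  proof
    fix z assume "z \<in> sweep (closed_segment p (p + of_real l * cis \<phi>)) {\<phi> + pi/2..\<phi> + pi/2 + \<alpha>}"
    then obtain s t where s: "0 \<le> s" "s \<le> 1" and t: "\<phi> + pi/2 \<le> t" "t \<le> \<phi> + pi/2 + \<alpha>"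
      and z: "z = (1 - s) *\<^sub>R p + s *\<^sub>R (p + of_real l * cis \<phi>) + cis t"
      by (auto simp: sweep_def closed_segment_def)
    define x :: "real^2" where "x = vector [s * l, t - \<phi> - pi/2]"
    have "x \<in> R"
      using s t assms by (auto simp: R x_def mult_left_le_one_le)
    moreover have "cos (t - pi/2) = sin t" "sin (t - pi/2) = - cos t"
      by (simp_all add: cos_diff sin_diff)
    then have "?h (f x) = z"
      by (simp add: complex_eq_iff f_def x_def z axis_def algebra_simps)
    ultimately show "z \<in> ?h ` f ` R" by blast
  qed
  have "compact (?h ` f ` R)"
    unfolding Complex_eq by (intro compact_continuous_image continuous_intros fR)
  then have "measure lebesgue (sweep (closed_segment p (p + of_real l * cis \<phi>)) {\<phi> + pi/2..\<phi> + pi/2 + \<alpha>})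
      \<le> measure lebesgue (?h ` f ` R)"
    by (intro measure_mono_fmeasurable sub)
      (simp_all add: compact_sweep lmeasurable_compact fmeasurableD)
  with meas show ?thesis
    by (simp add: measure_lebesgue_Complex_image fR)
qed

text \<open>Outer regularity gives an open set around the compact sweep with little excess area, and
  compactness leaves a margin \<open>\<delta>\<close> inside it. Moving a centre by at most
  \<open>\<delta>\<close> moves the points it touches by at most \<open>\<delta>\<close>.\<close>

lemma sweep_near_measure_le:
  assumes "compact S" "compact I" "e > 0"
  obtains \<delta> where "\<delta> > 0"
    "\<And>A. compact A \<Longrightarrow> A \<subseteq> (\<Union>s\<in>S. cball s \<delta>) \<Longrightarrow>
       measure lebesgue (sweep A I) \<le> measure lebesgue (sweep S I) + e"
proof -
  have comp: "compact (sweep S I)" by (rule compact_sweep[OF assms(1,2)])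
  then obtain T where T: "open T" "sweep S I \<subseteq> T" "T - sweep S I \<in> lmeasurable"
      "emeasure lebesgue (T - sweep S I) < ennreal e"
    using sets_lebesgue_outer_open[OF fmeasurableD[OF lmeasurable_compact] \<open>e > 0\<close>] by blast
  have Teq: "T = sweep S I \<union> (T - sweep S I)" using T(2) by blast
  have Tm: "T \<in> lmeasurable"
    by (subst Teq) (intro fmeasurable.Un lmeasurable_compact comp T(3))
  have "measure lebesgue T \<le> measure lebesgue (sweep S I) + measure lebesgue (T - sweep S I)"
    by (subst Teq) (intro measure_Un_le fmeasurableD lmeasurable_compact comp T(3))
  moreover have "measure lebesgue (T - sweep S I) < e"
    using T(3,4) by (simp add: emeasure_eq_measure2 ennreal_less_iff)
  ultimately have mT: "measure lebesgue T \<le> measure lebesgue (sweep S I) + e" by simp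
  obtain \<delta> where \<delta>: "\<delta> > 0" "(\<Union>x\<in>sweep S I. cball x \<delta>) \<subseteq> T"
    using compact_subset_open_imp_cball_epsilon_subset[OF comp T(1,2)] by blast
  show thesis
  proof
    fix A assume A: "compact A" "A \<subseteq> (\<Union>s\<in>S. cball s \<delta>)"
    have "sweep A I \<subseteq> T"
    proof
      fix z assume "z \<in> sweep A I"
      then obtain c t where c: "c \<in> A" and t: "t \<in> I" and z: "z = c + cis t"
        by (auto simp: sweep_def)
      from c A obtain s where s: "s \<in> S" "dist s c \<le> \<delta>" by auto
      have "s + cis t \<in> sweep S I" using s t by (auto simp: sweep_def)
      moreover have "z \<in> cball (s + cis t) \<delta>" using s z by (simp add: dist_norm)
      ultimately show "z \<in> T" using \<delta> by blast
    qed
    then have "measure lebesgue (sweep A I) \<le> measure lebesgue T"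
      using A assms by (intro measure_mono_fmeasurable Tm fmeasurableD lmeasurable_compact compact_sweep)
    with mT show "measure lebesgue (sweep A I) \<le> measure lebesgue (sweep S I) + e" by simp
  qed (rule \<delta>(1))
qed

section \<open>Plane isometries and their action on arcs\<close>

text \<open>The normalised map \<open>h\<close> fixes 0 and 1. Distances to these two points
  determine the real part; products of imaginary parts are preserved, so the sign at
  \<open>\<i>\<close> decides between identity and conjugation.\<close>

lemma plane_isometry_cases:
  assumes "plane_isometry f"
  obtains w where "norm w = 1" "(\<forall>z. f z = w * z + f 0) \<or> (\<forall>z. f z = w * cnj z + f 0)"
proof -
  have iso: "norm (f x - f y) = norm (x - y)" for x y
    using assms by (simp add: plane_isometry_def dist_norm)
  define w where "w = f 1 - f 0"
  have w: "norm w = 1" using iso[of 1 0] by (simp add: w_def)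
  define h where "h = (\<lambda>z. (f z - f 0) / w)"
  have f: "f z = w * h z + f 0" for z using w by (auto simp: h_def)
  have hiso: "norm (h x - h y) = norm (x - y)" for x y
    using iso[of x y] w by (simp add: h_def norm_divide flip: diff_divide_distrib)
  have h0: "h 0 = 0" and h1: "h 1 = 1" using w by (auto simp: h_def w_def)
  have sq: "(Re (h x) - Re (h y))\<^sup>2 + (Im (h x) - Im (h y))\<^sup>2 = (Re x - Re y)\<^sup>2 + (Im x - Im y)\<^sup>2" for x y
    using arg_cong[OF hiso[of x y], of "\<lambda>r. r\<^sup>2"] by (simp add: cmod_power2)
  have Re: "Re (h z) = Re z" for z
    using sq[of z 0] sq[of z 1] by (simp add: h0 h1 power2_eq_square algebra_simps)
  have prod: "Im (h x) * Im (h y) = Im x * Im y" for x y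
    using sq[of x y] sq[of x 0] sq[of y 0] by (simp add: h0 Re power2_eq_square algebra_simps)
  have "Im (h \<i>) = 1 \<or> Im (h \<i>) = -1"
    using prod[of \<i> \<i>] by (simp add: square_eq_1_iff)
  then have "(\<forall>z. h z = z) \<or> (\<forall>z. h z = cnj z)"
    using prod[of _ \<i>] Re by (auto simp: complex_eq_iff minus_equation_iff)
  then show thesis using that[OF w] f by metis
qed

text \<open>A reflected arc is an arc of the same length with its angles in reverse order, so an
  orientation-preserving motion can reach it as well.\<close>

lemma isometry_image_unit_arc:
  assumes "plane_isometry f"
  obtains c' a' where "f ` unit_arc c a L = unit_arc c' a' L"
proof -
  obtain w where w: "norm w = 1"
    and f: "(\<forall>z. f z = w * z + f 0) \<or> (\<forall>z. f z = w * cnj z + f 0)"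
    using plane_isometry_cases[OF assms] .
  obtain r where r: "w = cis r" using w by (metis complex_norm_eq_1_exp cis_conv_exp)
  from f show thesis
  proof
    assume f: "\<forall>z. f z = w * z + f 0"
    have "f ` unit_arc c a L = (\<lambda>\<theta>. f c + cis \<theta>) ` (\<lambda>\<theta>. r + \<theta>) ` {a..a + L}"
      unfolding unit_arc_def image_image
      by (intro image_cong refl) (subst f[rule_format], subst (2) f[rule_format], simp add: r algebra_simps cis_mult)
    also have "\<dots> = unit_arc (f c) (r + a) L"
      by (simp add: unit_arc_def add_ac)
    finally show thesis by (rule that)
  next
    assume f: "\<forall>z. f z = w * cnj z + f 0"
    have "f ` unit_arc c a L = (\<lambda>\<theta>. f c + cis \<theta>) ` (\<lambda>\<theta>. r - \<theta>) ` {a..a + L}"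
      unfolding unit_arc_def image_image
      by (intro image_cong refl) (subst f[rule_format], subst (2) f[rule_format], simp add: r algebra_simps cis_mult cis_cnj)
    \<comment> \<open>Reversal makes the image of \<open>a + L\<close> the left end of the angle
      interval.\<close>
    also have "\<dots> = unit_arc (f c) (r - a - L) L"
      by (simp add: unit_arc_def algebra_simps)
    finally show thesis by (rule that)
  qed
qed

section \<open>Motions as paths of centre and angle\<close>

text \<open>A pair \<open>(c, \<theta>)\<close> encodes the position \<open>unit_arc c \<theta> L\<close> of the arc; a motion is a path of such pairs.\<close>
definition touched :: "real \<Rightarrow> (complex \<times> real) set \<Rightarrow> complex set" where
  "touched L P = (\<lambda>((c, \<theta>), \<tau>). c + cis (\<theta> + \<tau>)) ` (P \<times> {0..L})"

lemma compact_touched: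
  assumes "compact P"
  shows "compact (touched L P)"
  unfolding touched_def case_prod_unfold
  by (intro compact_continuous_image continuous_intros compact_Times assms compact_Icc)

lemma touched_mono: "P \<subseteq> Q \<Longrightarrow> touched L P \<subseteq> touched L Q"
  unfolding touched_def by blast

lemma touched_Un: "touched L (P \<union> Q) = touched L P \<union> touched L Q"
  by (simp only: touched_def Sigma_Un_distrib1 image_Un)

lemma touched_Times_singleton: "touched L (A \<times> {\<theta>}) = sweep A {\<theta>..\<theta> + L}"
proof (intro set_eqI iffI)
  fix z assume "z \<in> touched L (A \<times> {\<theta>})"
  then obtain c \<tau> where "c \<in> A" "\<tau> \<in> {0..L}" "z = c + cis (\<theta> + \<tau>)"
    by (auto simp: touched_def)
  then show "z \<in> sweep A {\<theta>..\<theta> + L}"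
    unfolding sweep_def by (intro image_eqI[of _ _ "(c, \<theta> + \<tau>)"]) auto
next
  fix z assume "z \<in> sweep A {\<theta>..\<theta> + L}"
  then obtain c t where "c \<in> A" "t \<in> {\<theta>..\<theta> + L}" "z = c + cis t"
    by (auto simp: sweep_def)
  then show "z \<in> touched L (A \<times> {\<theta>})"
    unfolding touched_def by (intro image_eqI[of _ _ "((c, \<theta>), t - \<theta>)"]) auto
qed

lemma measure_touched_mono:
  assumes "P \<subseteq> Q" "compact P" "compact Q"
  shows "measure lebesgue (touched L P) \<le> measure lebesgue (touched L Q)"
  using assms
  by (intro measure_mono_fmeasurable touched_mono fmeasurableD lmeasurable_compact compact_touched)

lemma measure_touched_Un_le:
  assumes "compact P" "compact Q"
  shows "measure lebesgue (touched L (P \<union> Q))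
    \<le> measure lebesgue (touched L P) + measure lebesgue (touched L Q)"
  unfolding touched_Un using assms
  by (intro measure_Un_le fmeasurableD lmeasurable_compact compact_touched)

definition cheap_move :: "real \<Rightarrow> complex \<Rightarrow> complex \<Rightarrow> real \<Rightarrow> bool" where
  "cheap_move L p q e \<longleftrightarrow> (\<forall>\<theta> \<theta>'. \<exists>\<gamma>. path \<gamma> \<and> pathstart \<gamma> = (p, \<theta>) \<and> pathfinish \<gamma> = (q, \<theta>')
     \<and> measure lebesgue (touched L (path_image \<gamma>)) \<le> e)"

lemma path_join_touched:
  assumes "path \<gamma>1" "path \<gamma>2" "pathfinish \<gamma>1 = pathstart \<gamma>2"
  shows "measure lebesgue (touched L (path_image (\<gamma>1 +++ \<gamma>2)))
    \<le> measure lebesgue (touched L (path_image \<gamma>1)) + measure lebesgue (touched L (path_image \<gamma>2))"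
  using assms by (simp add: path_image_join measure_touched_Un_le compact_path_image)

text \<open>All touched points lie on the unit circle around \<open>p\<close>, a null set.\<close>

lemma measure_touched_rotation:
  "measure lebesgue (touched L (path_image (linepath (p, \<theta>) (p, \<theta>')))) = 0"
proof -
  have "touched L (path_image (linepath (p, \<theta>) (p, \<theta>'))) \<subseteq> sphere p 1"
  proof
    fix z assume "z \<in> touched L (path_image (linepath (p, \<theta>) (p, \<theta>')))"
    then obtain x \<tau> where x: "x \<in> closed_segment (p, \<theta>) (p, \<theta>')" and z: "z = fst x + cis (snd x + \<tau>)"
      by (auto simp: touched_def)
    from x have "fst x = p"
      by (auto simp: in_segment simp flip: scaleR_add_left)
    with z show "z \<in> sphere p 1"
      by (simp add: dist_norm)
  qed
  then have "negligible (touched L (path_image (linepath (p, \<theta>) (p, \<theta>'))))"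
    by (meson negligible_sphere negligible_subset)
  then show ?thesis by (rule negligible_imp_measure0)
qed

text \<open>Turning the arc about its centre costs no area, so the initial and final angles of a
  motion are irrelevant.\<close>
lemma cheap_moveI:
  assumes "path \<gamma>" "pathstart \<gamma> = (p, \<theta>1)" "pathfinish \<gamma> = (q, \<theta>2)"
    "measure lebesgue (touched L (path_image \<gamma>)) \<le> e"
  shows "cheap_move L p q e"
  unfolding cheap_move_def
proof (intro allI)
  fix \<theta> \<theta>'
  let ?\<gamma> = "linepath (p, \<theta>) (p, \<theta>1) +++ (\<gamma> +++ linepath (q, \<theta>2) (q, \<theta>'))"
  have "measure lebesgue (touched L (path_image ?\<gamma>)) \<le> 0 + (e + 0)"
    using assms
    by (intro order_trans[OF path_join_touched] add_mono)
      (auto simp: measure_touched_rotation simp del: path_image_linepath)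
  then show "\<exists>\<gamma>. path \<gamma> \<and> pathstart \<gamma> = (p, \<theta>) \<and> pathfinish \<gamma> = (q, \<theta>')
     \<and> measure lebesgue (touched L (path_image \<gamma>)) \<le> e"
    using assms by (intro exI[of _ ?\<gamma>]) auto
qed

lemma cheap_move_mono: "cheap_move L p q e \<Longrightarrow> e \<le> e' \<Longrightarrow> cheap_move L p q e'"
  unfolding cheap_move_def by (meson order_trans)

text \<open>\<open>k\<close> is an area per unit length of displacement. The slack \<open>e\<close>
  leaves room for rates that are only approached by ever finer zigzags.\<close>

definition cost_rate :: "real \<Rightarrow> real \<Rightarrow> bool" where
  "cost_rate L k \<longleftrightarrow> (\<forall>p v. \<forall>e>0. cheap_move L p (p + v) (k * norm v + e))"

lemma path_image_translation:
  "path_image (linepath (p, \<theta>) (q, \<theta>)) \<subseteq> closed_segment p q \<times> {\<theta>}"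
proof
  fix z assume "z \<in> path_image (linepath (p, \<theta>) (q, \<theta>))"
  then obtain u where u: "0 \<le> u" "u \<le> 1" "z = (1 - u) *\<^sub>R (p, \<theta>) + u *\<^sub>R (q, \<theta>)"
    by (auto simp: in_segment)
  then have "fst z = (1 - u) *\<^sub>R p + u *\<^sub>R q" "snd z = \<theta>"
    by (simp_all add: algebra_simps)
  then show "z \<in> closed_segment p q \<times> {\<theta>}"
    using u by (auto simp: in_segment mem_Times_iff)
qed

text \<open>The arc is first turned until one end is tangent to the direction of motion. All its
  angles are then within \<open>L\<close> of tangency, and the bound for almost tangent pieces
  applies with \<open>\<alpha> = L\<close>.\<close>

lemma cost_rate_initial:
  assumes "0 \<le> L"
  shows "cost_rate L (L\<^sup>2)"
  unfolding cost_rate_def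
proof (intro allI impI)
  fix p v :: complex and e :: real
  assume "e > 0"
  define \<phi> where "\<phi> = Arg v"
  have v: "v = of_real (norm v) * cis \<phi>"
    unfolding \<phi>_def by (metis rcis_cmod_Arg rcis_def)
  let ?g = "linepath (p, \<phi> + pi/2) (p + v, \<phi> + pi/2)"
  have "measure lebesgue (touched L (path_image ?g))
      \<le> measure lebesgue (touched L (closed_segment p (p + v) \<times> {\<phi> + pi/2}))"
    by (intro measure_touched_mono path_image_translation compact_path_image path_linepath
        compact_Times compact_segment) simp
  also have "\<dots> = measure lebesgue (sweep (closed_segment p (p + of_real (norm v) * cis \<phi>))
      {\<phi> + pi/2..\<phi> + pi/2 + L})"
    unfolding touched_Times_singleton v[symmetric] ..
  also have "\<dots> \<le> norm v * L\<^sup>2"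
    using assms by (intro measure_sweep_closed_segment_le) auto
  finally show "cheap_move L p (p + v) (L\<^sup>2 * norm v + e)"
    using \<open>e > 0\<close> by (intro cheap_moveI[of ?g]) (auto simp: mult.commute)
qed

section \<open>Zigzag refinement\<close>

text \<open>A motion from \<open>x\<close> to \<open>y\<close> is split into a main part, in which the arc keeps the initial angle
  \<open>\<theta>\<close> and its centre stays in \<open>D\<close>, and a remainder. The area of the latter is at most \<open>e1\<close>, and
  the part \<open>W\<close> of the arc touches at most \<open>e2\<close> during the main part.\<close>
definition split_move ::
    "real \<Rightarrow> real \<Rightarrow> complex set \<Rightarrow> real set \<Rightarrow> complex \<Rightarrow> complex \<Rightarrow> real \<Rightarrow> real \<Rightarrow> bool" where
  "split_move L \<theta> D W x y e1 e2 \<longleftrightarrow> (\<exists>\<gamma> A B. path \<gamma> \<and> pathstart \<gamma> = (x, \<theta>) \<and> pathfinish \<gamma> = (y, \<theta>)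
     \<and> path_image \<gamma> \<subseteq> A \<times> {\<theta>} \<union> B \<and> compact A \<and> compact B \<and> A \<subseteq> D
     \<and> measure lebesgue (touched L B) \<le> e1 \<and> measure lebesgue (sweep A W) \<le> e2)"

lemma split_move_mono:
  assumes "split_move L \<theta> D W x y e1 e2" "D \<subseteq> D'" "e1 \<le> e1'" "e2 \<le> e2'"
  shows "split_move L \<theta> D' W x y e1' e2'"
  using assms unfolding split_move_def by (meson order_trans)

lemma split_move_trans:
  assumes "split_move L \<theta> D W x y e1 e2" "split_move L \<theta> D W y z e1' e2'" "compact W"
  shows "split_move L \<theta> D W x z (e1 + e1') (e2 + e2')"
proof -
  obtain \<gamma> A B where 1: "path \<gamma>" "pathstart \<gamma> = (x, \<theta>)" "pathfinish \<gamma> = (y, \<theta>)"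
    "path_image \<gamma> \<subseteq> A \<times> {\<theta>} \<union> B" "compact A" "compact B" "A \<subseteq> D"
    "measure lebesgue (touched L B) \<le> e1" "measure lebesgue (sweep A W) \<le> e2"
    using assms(1) unfolding split_move_def by blast
  obtain \<gamma>' A' B' where 2: "path \<gamma>'" "pathstart \<gamma>' = (y, \<theta>)" "pathfinish \<gamma>' = (z, \<theta>)"
    "path_image \<gamma>' \<subseteq> A' \<times> {\<theta>} \<union> B'" "compact A'" "compact B'" "A' \<subseteq> D"
    "measure lebesgue (touched L B') \<le> e1'" "measure lebesgue (sweep A' W) \<le> e2'"
    using assms(2) unfolding split_move_def by blast
  have "measure lebesgue (sweep (A \<union> A') W) \<le> measure lebesgue (sweep A W) + measure lebesgue (sweep A' W)"
    unfolding sweep_Un_left using 1 2 assms(3)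
    by (intro measure_Un_le fmeasurableD lmeasurable_compact compact_sweep)
  moreover have "measure lebesgue (touched L (B \<union> B')) \<le> e1 + e1'"
    using measure_touched_Un_le[of B B' L] 1 2 by simp
  moreover have "path_image (\<gamma> +++ \<gamma>') \<subseteq> (A \<union> A') \<times> {\<theta>} \<union> (B \<union> B')"
    using 1 2 by (simp add: path_image_join) blast
  ultimately show ?thesis
    using 1 2 unfolding split_move_def
    by (intro exI[of _ "\<gamma> +++ \<gamma>'"] exI[of _ "A \<union> A'"] exI[of _ "B \<union> B'"]) auto
qed

lemma split_move_iterate:
  assumes "\<And>i. i < n \<Longrightarrow> split_move L \<theta> D W (x i) (x (Suc i)) e1 e2" "compact W" "n > 0"
  shows "split_move L \<theta> D W (x 0) (x n) (real n * e1) (real n * e2)"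
  using \<open>n > 0\<close> assms(1)
proof (induction n rule: nat_induct_non_zero)
  case 1
  then show ?case by simp
next
  case (Suc n)
  then have "split_move L \<theta> D W (x 0) (x (Suc n)) (real n * e1 + e1) (real n * e2 + e2)"
    by (intro split_move_trans[OF _ _ \<open>compact W\<close>]) auto
  then show ?case by (simp add: algebra_simps)
qed

text \<open>The main part is taken empty; this is how side steps enter a zigzag.\<close>

lemma cheap_move_imp_split_move:
  assumes "cheap_move L x y e"
  shows "split_move L \<theta> D W x y e 0"
proof -
  obtain \<gamma> where "path \<gamma>" "pathstart \<gamma> = (x, \<theta>)" "pathfinish \<gamma> = (y, \<theta>)"
     "measure lebesgue (touched L (path_image \<gamma>)) \<le> e"
    using assms unfolding cheap_move_def by blast
  then show ?thesis
    unfolding split_move_def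
    by (intro exI[of _ \<gamma>] exI[of _ "{}"] exI[of _ "path_image \<gamma>"]) (auto simp: compact_path_image)
qed

text \<open>Once \<open>W\<close> is the whole arc, the two bounds together cover everything
  touched.\<close>

lemma split_move_imp_cheap_move:
  assumes "split_move L \<theta> D {\<theta>..\<theta> + L} x y e1 e2"
  shows "cheap_move L x y (e1 + e2)"
proof -
  obtain \<gamma> A B where 1: "path \<gamma>" "pathstart \<gamma> = (x, \<theta>)" "pathfinish \<gamma> = (y, \<theta>)"
    "path_image \<gamma> \<subseteq> A \<times> {\<theta>} \<union> B" "compact A" "compact B" "A \<subseteq> D"
    "measure lebesgue (touched L B) \<le> e1" "measure lebesgue (sweep A {\<theta>..\<theta> + L}) \<le> e2"
    using assms unfolding split_move_def by blast
  have "measure lebesgue (touched L (path_image \<gamma>)) \<le> measure lebesgue (touched L (A \<times> {\<theta>} \<union> B))"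
    using 1 by (intro measure_touched_mono compact_Un compact_Times compact_path_image) auto
  also have "\<dots> \<le> measure lebesgue (touched L (A \<times> {\<theta>})) + measure lebesgue (touched L B)"
    using 1 by (intro measure_touched_Un_le compact_Times) auto
  finally show ?thesis
    using 1 by (intro cheap_moveI[of \<gamma>]) (auto simp: touched_Times_singleton)
qed

text \<open>Here \<open>\<psi>\<close> is the final direction of the main part, and \<open>\<psi> - pi/2\<close> is the direction of the
  side steps. The segment is replaced by a fine zigzag whose main steps are turned by \<open>\<alpha>\<close>; later
  refinements stay so close to the segment that the points of the arc almost tangent to it
  never touch more than a small neighbourhood of what they touch during the translation along it.\<close>
lemma split_move_turning:
  assumes "cost_rate L k" "0 < \<alpha>" "real m * \<alpha> < pi/2" "0 \<le> l" "0 < \<delta>" "0 < e"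
  shows "split_move L \<theta> (\<Union>s\<in>closed_segment p (p + of_real l * cis (\<psi> - real m * \<alpha>)). cball s \<delta>)
    {\<psi> - real m * \<alpha> + pi/2..\<psi> + pi/2} p (p + of_real l * cis (\<psi> - real m * \<alpha>))
    (k * l * sin (real m * \<alpha>) + e) (real m * l * \<alpha>\<^sup>2 + e)"
  using assms(3-)
proof (induction m arbitrary: p l \<delta> e)
  case 0
  let ?S = "closed_segment p (p + of_real l * cis \<psi>)"
  \<comment> \<open>A single point of the arc touches only a translate of the segment, so its area
    is 0.\<close>
  have "measure lebesgue (sweep ?S {\<psi> + pi/2..\<psi> + pi/2 + 0}) \<le> l * 0\<^sup>2"
    using 0 by (intro measure_sweep_closed_segment_le) auto
  moreover have "?S \<subseteq> (\<Union>s\<in>?S. cball s \<delta>)"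
    using \<open>0 < \<delta>\<close> by force
  ultimately have "split_move L \<theta> (\<Union>s\<in>?S. cball s \<delta>) {\<psi> + pi/2..\<psi> + pi/2}
      p (p + of_real l * cis \<psi>) e e"
    unfolding split_move_def using 0 path_image_translation[of p \<theta> "p + of_real l * cis \<psi>"]
    by (intro exI[of _ "linepath (p, \<theta>) (p + of_real l * cis \<psi>, \<theta>)"] exI[of _ ?S] exI[of _ "{}"])
      (auto simp: touched_def)
  then show ?case by simp
next
  case (Suc m)
  define \<beta> where "\<beta> = real m * \<alpha>"
  have \<beta>: "0 \<le> \<beta>" "\<beta> + \<alpha> < pi/2" "real (Suc m) * \<alpha> = \<beta> + \<alpha>"
    using Suc.prems \<open>0 < \<alpha>\<close> by (auto simp: \<beta>_def algebra_simps)
  define v where "v = of_real l * cis (\<psi> - (\<beta> + \<alpha>))"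
  \<comment> \<open>\<open>l'\<close> and \<open>r\<close> are the components of \<open>v\<close> in
    the main direction \<open>\<psi> - \<beta>\<close> and the side direction
    \<open>\<psi> - pi/2\<close>.\<close>
  define l' where "l' = l * cos (\<beta> + \<alpha>) / cos \<beta>"
  define r where "r = l * sin (\<beta> + \<alpha>) - l' * sin \<beta>"
  have cos_pos: "cos \<beta> > 0" "cos (\<beta> + \<alpha>) > 0"
    using \<beta> \<open>0 < \<alpha>\<close> by (auto intro!: cos_gt_zero_pi)
  have cos_le: "cos (\<beta> + \<alpha>) \<le> cos \<beta>"
    using \<beta> \<open>0 < \<alpha>\<close> by (intro cos_monotone_0_pi_le) auto
  have l': "0 \<le> l'" "l' \<le> l"
    using cos_pos cos_le \<open>0 \<le> l\<close> by (auto simp: l'_def divide_le_eq mult_left_mono)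
  have r: "0 \<le> r"
  proof -
    have "r = l * (sin (\<beta> + \<alpha>) * cos \<beta> - cos (\<beta> + \<alpha>) * sin \<beta>) / cos \<beta>"
      using cos_pos by (simp add: r_def l'_def field_simps)
    also have "sin (\<beta> + \<alpha>) * cos \<beta> - cos (\<beta> + \<alpha>) * sin \<beta> = sin \<alpha>"
      using sin_diff[of "\<beta> + \<alpha>" \<beta>] by simp
    finally show ?thesis
      using cos_pos \<open>0 \<le> l\<close> \<beta> \<open>0 < \<alpha>\<close> by (simp add: sin_ge_zero)
  qed
  have v_split: "v = of_real l' * cis (\<psi> - \<beta>) + of_real r * cis (\<psi> - pi/2)"
  proof -
    have c: "cis (\<psi> - t) = cis \<psi> * cis (- t)" for t
      by (simp add: cis_mult)
    have "of_real l * cis (- (\<beta> + \<alpha>)) = of_real l' * cis (- \<beta>) + of_real r * cis (- (pi/2))"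
      using cos_pos by (simp add: complex_eq_iff r_def l'_def del: minus_add_distrib)
    then show ?thesis
      unfolding v_def c by (simp only: mult.left_commute[of _ "cis \<psi>"] flip: distrib_left)
  qed
  let ?S = "closed_segment p (p + v)"
  let ?I = "{\<psi> - (\<beta> + \<alpha>) + pi/2..\<psi> - (\<beta> + \<alpha>) + pi/2 + \<alpha>}"
  let ?W = "{\<psi> - \<beta> + pi/2..\<psi> + pi/2}"
  obtain \<delta>1 where \<delta>1: "\<delta>1 > 0" "\<And>A. compact A \<Longrightarrow> A \<subseteq> (\<Union>s\<in>?S. cball s \<delta>1) \<Longrightarrow>
       measure lebesgue (sweep A ?I) \<le> measure lebesgue (sweep ?S ?I) + e/2"
    using sweep_near_measure_le[of ?S ?I "e/2"] \<open>0 < e\<close> by (auto simp: compact_segment)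
  have mS: "measure lebesgue (sweep ?S ?I) \<le> l * \<alpha>\<^sup>2"
    unfolding v_def using \<open>0 \<le> l\<close> \<open>0 < \<alpha>\<close> by (intro measure_sweep_closed_segment_le) auto
  \<comment> \<open>\<open>\<delta>\<close> is the tolerance demanded from outside,
    \<open>\<delta>1\<close> the one that protects the estimate for \<open>?I\<close>.\<close>
  define \<delta>0 where "\<delta>0 = min \<delta> \<delta>1"
  have \<delta>0: "\<delta>0 > 0" using \<delta>1 Suc.prems by (simp add: \<delta>0_def)
  \<comment> \<open>A main step is then at most \<open>\<delta>0 / 2\<close> long, and its
    refinements deviate by at most \<open>\<delta>0 / 2\<close> more.\<close>
  obtain n :: nat where n: "2 * l / \<delta>0 < real n" "n > 0"
    using reals_Archimedean2[of "max 1 (2 * l / \<delta>0)"] by (auto simp: max_def split: if_splits)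
  define x where "x = (\<lambda>i. p + of_real (real i / real n) * v)"
  define D where "D = (\<Union>s\<in>?S. cball s \<delta>0)"
  \<comment> \<open>Each main step and each side step gets the error \<open>e / (2 * n)\<close>. For
    the main part this adds up to \<open>e/2\<close>; the other half is kept for
    \<open>?I\<close>.\<close>
  have "split_move L \<theta> D ?W (x i) (x (Suc i))
      ((k * l * sin (\<beta> + \<alpha>) + e) / n) ((real m * l * \<alpha>\<^sup>2 + e/2) / n)" if "i < n" for i
  proof -
    let ?a = "of_real (l' / n) * cis (\<psi> - \<beta>)"
    let ?b = "of_real (r / n) * cis (\<psi> - pi/2)"
    have ab: "x (Suc i) = x i + ?a + ?b"
    proof -
      have "x (Suc i) = x i + v / n"
        using n by (simp add: x_def field_simps)
      also have "v / n = ?a + ?b"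
        by (simp add: v_split add_divide_distrib)
      finally show ?thesis by (simp add: add.assoc)
    qed
    have xi: "x i \<in> ?S"
      unfolding closed_segment_def using \<open>i < n\<close>
      by (auto simp: x_def scaleR_conv_of_real algebra_simps intro!: exI[of _ "real i / real n"])
    have "l / n \<le> \<delta>0 / 2"
      using n \<delta>0 by (simp add: field_simps)
    moreover have "norm ?a = l' / n"
      using l' by (simp add: norm_mult norm_divide)
    moreover have "l' / n \<le> l / n"
      using l' by (intro divide_right_mono) auto
    ultimately have na: "norm ?a \<le> \<delta>0 / 2" by linarith
    have "split_move L \<theta> (\<Union>s\<in>closed_segment (x i) (x i + ?a). cball s (\<delta>0/2)) ?W (x i) (x i + ?a)
      (k * (l' / n) * sin \<beta> + e / (2 * n)) (real m * (l' / n) * \<alpha>\<^sup>2 + e / (2 * n))"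
      unfolding \<beta>_def using Suc.prems \<open>0 < \<alpha>\<close> l' \<delta>0 n
      by (intro Suc.IH) (auto simp: algebra_simps)
    moreover have "(\<Union>s\<in>closed_segment (x i) (x i + ?a). cball s (\<delta>0/2)) \<subseteq> D"
    proof
      fix z assume "z \<in> (\<Union>s\<in>closed_segment (x i) (x i + ?a). cball s (\<delta>0/2))"
      then obtain s where s: "s \<in> closed_segment (x i) (x i + ?a)" "dist s z \<le> \<delta>0/2" by auto
      have "dist (x i) s \<le> \<delta>0/2"
        using segment_bound(1)[OF s(1)] na by (simp add: dist_norm norm_minus_commute)
      then have "dist (x i) z \<le> \<delta>0"
        using s(2) dist_triangle[of "x i" z s] by simp
      then show "z \<in> D" using xi by (auto simp: D_def)
    qed
    ultimately have main: "split_move L \<theta> D ?W (x i) (x i + ?a)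
      (k * (l' / n) * sin \<beta> + e / (2 * n)) (real m * (l' / n) * \<alpha>\<^sup>2 + e / (2 * n))"
      by (rule split_move_mono) auto
    have "cheap_move L (x i + ?a) (x i + ?a + ?b) (k * norm ?b + e / (2 * n))"
      using \<open>cost_rate L k\<close> n \<open>0 < e\<close> unfolding cost_rate_def by simp
    moreover have "norm ?b = r / n" using r by (simp add: norm_mult norm_divide)
    ultimately have "split_move L \<theta> D ?W (x i + ?a) (x (Suc i)) (k * (r / n) + e / (2 * n)) 0"
      by (metis ab cheap_move_imp_split_move)
    from split_move_trans[OF main this compact_Icc] show ?thesis
    proof (rule split_move_mono)
      \<comment> \<open>Since \<open>l' * sin \<beta> + r = l * sin (\<beta> + \<alpha>)\<close>,
        the side steps of this stage and of the finer ones add up exactly.\<close>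
      show "k * (l' / n) * sin \<beta> + e / (2 * n) + (k * (r / n) + e / (2 * n))
          \<le> (k * l * sin (\<beta> + \<alpha>) + e) / n"
        using n by (simp add: r_def add_divide_distrib diff_divide_distrib algebra_simps)
      have "real m * l' * \<alpha>\<^sup>2 \<le> real m * l * \<alpha>\<^sup>2"
        using l' by (intro mult_right_mono mult_left_mono) auto
      then have "(real m * l' * \<alpha>\<^sup>2 + e/2) / n \<le> (real m * l * \<alpha>\<^sup>2 + e/2) / n"
        by (intro divide_right_mono) auto
      then show "real m * (l' / n) * \<alpha>\<^sup>2 + e / (2 * n) + 0 \<le> (real m * l * \<alpha>\<^sup>2 + e/2) / n"
        by (simp add: add_divide_distrib)
    qed simp
  qed
  from split_move_iterate[where x = x, OF this compact_Icc \<open>n > 0\<close>]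
  have "split_move L \<theta> D ?W (x 0) (x n) (k * l * sin (\<beta> + \<alpha>) + e) (real m * l * \<alpha>\<^sup>2 + e/2)"
    using n by simp
  moreover have "x 0 = p" "x n = p + v" using n by (simp_all add: x_def)
  ultimately obtain \<gamma> A B where 1: "path \<gamma>" "pathstart \<gamma> = (p, \<theta>)" "pathfinish \<gamma> = (p + v, \<theta>)"
    "path_image \<gamma> \<subseteq> A \<times> {\<theta>} \<union> B" "compact A" "compact B" "A \<subseteq> D"
    "measure lebesgue (touched L B) \<le> k * l * sin (\<beta> + \<alpha>) + e"
    "measure lebesgue (sweep A ?W) \<le> real m * l * \<alpha>\<^sup>2 + e/2"
    unfolding split_move_def by auto
  \<comment> \<open>\<open>?I\<close> is almost tangent to the unrefined segment and is paid for
    here; \<open>?W\<close> is paid for by the finer stages.\<close>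
  have W: "{\<psi> - (\<beta> + \<alpha>) + pi/2..\<psi> + pi/2} = ?I \<union> ?W"
    using \<beta> \<open>0 < \<alpha>\<close> by auto
  have "D \<subseteq> (\<Union>s\<in>?S. cball s \<delta>1)" and D: "D \<subseteq> (\<Union>s\<in>?S. cball s \<delta>)"
    by (auto simp: D_def \<delta>0_def)
  then have "measure lebesgue (sweep A ?I) \<le> l * \<alpha>\<^sup>2 + e/2"
    using \<delta>1(2)[OF 1(5) order_trans[OF 1(7)]] mS by linarith
  moreover have "measure lebesgue (sweep A (?I \<union> ?W)) \<le> measure lebesgue (sweep A ?I) + measure lebesgue (sweep A ?W)"
    unfolding sweep_Un_right
    by (intro measure_Un_le fmeasurableD lmeasurable_compact compact_sweep 1 compact_Icc)
  ultimately have "measure lebesgue (sweep A (?I \<union> ?W)) \<le> real (Suc m) * l * \<alpha>\<^sup>2 + e"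
    using 1 by (simp add: algebra_simps)
  then show ?case
    unfolding \<beta>(3) v_def[symmetric] W split_move_def
    by (intro exI[of _ \<gamma>] exI[of _ A] exI[of _ B] conjI 1 order_trans[OF 1(7) D])
qed

text \<open>After the main direction has turned through the angle \<open>L\<close>, every point of the arc has been
  almost tangent to the main direction; only the side steps, of total length \<open>norm v * sin L\<close>, remain.\<close>
lemma cost_rate_improve:
  assumes "cost_rate L k" "0 < L" "L < pi/2"
  shows "cost_rate L (k * sin L)"
  unfolding cost_rate_def
proof (intro allI impI)
  fix p v :: complex and e :: real
  assume e: "e > 0"
  define l where "l = norm v"
  have v: "v = of_real l * cis (Arg v)"
    unfolding l_def by (metis rcis_cmod_Arg rcis_def)
  \<comment> \<open>The main part costs \<open>l * L\<^sup>2 / m\<close>, so this \<open>m\<close>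
    brings it down to \<open>e/2\<close>.\<close>
  obtain m :: nat where m: "l * L\<^sup>2 / (e/2) < real m" "m > 0"
    using reals_Archimedean2[of "max 1 (l * L\<^sup>2 / (e/2))"] by (auto simp: max_def split: if_splits)
  define \<alpha> where "\<alpha> = L / m"
  have \<alpha>: "\<alpha> > 0" "real m * \<alpha> = L" using m assms by (auto simp: \<alpha>_def)
  \<comment> \<open>The main direction starts as that of \<open>v\<close> and turns by
    \<open>L\<close>. With start angle \<open>Arg v + pi/2\<close> the piece of the arc that is
    controlled is then the whole arc. The neighbourhood radius 1 below is arbitrary.\<close>
  define \<psi> where "\<psi> = Arg v + L"
  have "split_move L (Arg v + pi/2) (\<Union>s\<in>closed_segment p (p + of_real l * cis (\<psi> - real m * \<alpha>)). cball s 1)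
    {\<psi> - real m * \<alpha> + pi/2..\<psi> + pi/2} p (p + of_real l * cis (\<psi> - real m * \<alpha>))
    (k * l * sin (real m * \<alpha>) + e/4) (real m * l * \<alpha>\<^sup>2 + e/4)"
    using \<alpha> assms e by (intro split_move_turning) (auto simp: l_def)
  moreover have "\<psi> - L + pi/2 = Arg v + pi/2" "\<psi> + pi/2 = Arg v + pi/2 + L" "\<psi> - L = Arg v"
    by (auto simp: \<psi>_def)
  ultimately have "split_move L (Arg v + pi/2) (\<Union>s\<in>closed_segment p (p + v). cball s 1)
      {Arg v + pi/2..Arg v + pi/2 + L} p (p + v) (k * l * sin L + e/4) (real m * l * \<alpha>\<^sup>2 + e/4)"
    by (simp only: \<alpha>(2) flip: v)
  then have "cheap_move L p (p + v) ((k * l * sin L + e/4) + (real m * l * \<alpha>\<^sup>2 + e/4))"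
    by (rule split_move_imp_cheap_move)
  moreover have "(k * l * sin L + e/4) + (real m * l * \<alpha>\<^sup>2 + e/4) \<le> k * sin L * norm v + e"
  proof -
    have "real m * l * \<alpha>\<^sup>2 = l * L\<^sup>2 / m"
      using m by (simp add: \<alpha>_def power2_eq_square)
    also have "\<dots> \<le> e/2"
      using m e by (simp add: field_simps)
    finally show ?thesis by (simp add: l_def mult_ac)
  qed
  ultimately show "cheap_move L p (p + v) (k * sin L * norm v + e)"
    by (rule cheap_move_mono)
qed

section \<open>Iteration and conclusion\<close>

text \<open>Each improvement multiplies the rate by \<open>sin L < 1\<close>, so the rates
  \<open>L\<^sup>2 * sin L ^ n\<close> tend to 0.\<close>

lemma cheap_move_any:
  assumes "0 < L" "L < pi/2" "e > 0"
  shows "cheap_move L p q e"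
proof -
  have rate: "cost_rate L (L\<^sup>2 * sin L ^ n)" for n
  proof (induction n)
    case 0
    then show ?case using assms cost_rate_initial[of L] by simp
  next
    case (Suc n)
    then show ?case
      using cost_rate_improve[OF Suc.IH assms(1,2)] by (simp add: mult_ac)
  qed
  have sin: "0 \<le> sin L" "sin L < 1"
    using assms sin_monotone_2pi[of L "pi/2"] by (auto intro: sin_ge_zero)
  then have "(\<lambda>n. L\<^sup>2 * sin L ^ n * norm (q - p)) \<longlonglongrightarrow> L\<^sup>2 * 0 * norm (q - p)"
    by (intro tendsto_intros LIMSEQ_realpow_zero)
  then have "\<forall>\<^sub>F n in sequentially. L\<^sup>2 * sin L ^ n * norm (q - p) < e/2"
    using \<open>e > 0\<close> by (intro order_tendstoD(2)) auto
  then obtain n where n: "L\<^sup>2 * sin L ^ n * norm (q - p) < e/2"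
    by (auto simp: eventually_sequentially)
  have "cheap_move L p q (L\<^sup>2 * sin L ^ n * norm (q - p) + e/2)"
    using rate[of n, unfolded cost_rate_def, rule_format, of "e/2" p "q - p"] \<open>e > 0\<close> by simp
  then show ?thesis
    by (rule cheap_move_mono) (use n in simp)
qed

theorem theorem1:
  fixes c :: complex and a L \<epsilon> :: real and f :: "complex \<Rightarrow> complex"
  assumes "0 < L" and "L < 1.32"
    and "plane_isometry f"
    and "\<epsilon> > 0"
  shows "\<exists>u b. continuous_motion u b
           \<and> motion_map u b 0 = id
           \<and> motion_map u b 1 ` unit_arc c a L = f ` unit_arc c a L
           \<and> (\<Union>t\<in>{0..1}. motion_map u b t ` unit_arc c a L) \<in> sets lebesgue
           \<and> emeasure lebesgue (\<Union>t\<in>{0..1}. motion_map u b t ` unit_arc c a L) < ennreal \<epsilon>"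
proof -
  have "L < pi/2" using assms(2) pi_gt3 by simp
  obtain c' a' where f: "f ` unit_arc c a L = unit_arc c' a' L"
    using isometry_image_unit_arc[OF assms(3)] .
  have "cheap_move L c c' (\<epsilon>/2)"
    using assms \<open>L < pi/2\<close> by (intro cheap_move_any) auto
  then obtain \<gamma> where \<gamma>: "path \<gamma>" "pathstart \<gamma> = (c, a)" "pathfinish \<gamma> = (c', a')"
      and meas: "measure lebesgue (touched L (path_image \<gamma>)) \<le> \<epsilon>/2"
    unfolding cheap_move_def by blast
  \<comment> \<open>The isometry at time \<open>t\<close> is the one that takes the position
    \<open>(c, a)\<close> to \<open>\<gamma> t\<close>: \<open>u\<close> turns by the change of
    angle, and \<open>b\<close> sends \<open>c\<close> to the current centre.\<close>
  define u where "u = (\<lambda>t. cis (snd (\<gamma> t) - a))"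
  define b where "b = (\<lambda>t. fst (\<gamma> t) - u t * c)"
  have cont: "continuous_on {0..1} \<gamma>" using \<gamma>(1) by (simp add: path_def)
  have motion: "motion_map u b t (c + cis \<theta>) = fst (\<gamma> t) + cis (snd (\<gamma> t) + (\<theta> - a))" for t \<theta>
    by (simp add: motion_map_def b_def u_def algebra_simps cis_mult)
  have image: "motion_map u b t ` unit_arc c a L = touched L {\<gamma> t}" for t
  proof -
    have "(\<lambda>\<theta>. \<theta> - a) ` {a..a + L} = {0..L}" by simp
    moreover have "touched L {\<gamma> t} = (\<lambda>\<tau>. fst (\<gamma> t) + cis (snd (\<gamma> t) + \<tau>)) ` {0..L}"
      by (force simp: touched_def case_prod_unfold)
    ultimately have "touched L {\<gamma> t} = (\<lambda>\<tau>. fst (\<gamma> t) + cis (snd (\<gamma> t) + \<tau>)) ` (\<lambda>\<theta>. \<theta> - a) ` {a..a + L}"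
      by simp
    then show ?thesis
      by (simp only: unit_arc_def image_image motion)
  qed
  have union: "(\<Union>t\<in>{0..1}. motion_map u b t ` unit_arc c a L) = touched L (path_image \<gamma>)"
    unfolding image touched_def path_image_def by blast
  have "compact (touched L (path_image \<gamma>))"
    using \<gamma> by (intro compact_touched compact_path_image)
  then have lm: "touched L (path_image \<gamma>) \<in> lmeasurable" by (rule lmeasurable_compact)
  have "continuous_motion u b"
    unfolding continuous_motion_def b_def u_def
    by (auto intro!: continuous_intros cont)
  moreover have "motion_map u b 0 = id"
    using \<gamma>(2) by (auto simp: motion_map_def b_def u_def pathstart_def)
  moreover have "motion_map u b 1 ` unit_arc c a L = f ` unit_arc c a L"
  proof -
    have "touched L {\<gamma> 1} = sweep {c'} {a'..a' + L}"
      using \<gamma>(3) touched_Times_singleton[of L "{c'}" a'] by (simp add: pathfinish_def)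
    then show ?thesis
      unfolding image f by (auto simp: sweep_def unit_arc_def)
  qed
  moreover have "emeasure lebesgue (touched L (path_image \<gamma>)) < ennreal \<epsilon>"
    using lm meas assms(4) by (simp add: emeasure_eq_measure2 ennreal_less_iff)
  ultimately show ?thesis
    using fmeasurableD[OF lm] unfolding union[symmetric] by (intro exI[of _ u] exI[of _ b] conjI)
qed

end
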